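(* Let $Z$ be a constructible set in $\mathbb R^n$ and take $R_k\in\mathbb R[X_1,\dots,X_n]$, $k=1,\dots,r$. For $I\subset\{1,\dots,r\}$ a subset of cardinality $\sharp I=i$ and $\varepsilon=(\varepsilon_j)_{j\in I}\in\{\pm1\}^i$, denote by $R_{I,\varepsilon}$ the real constructible set defined by $$R_{I,\varepsilon}=\{Y_j^2=\varepsilon_jR_j(X),\ j\in I;\ R_k(X)\neq0,\ k\notin I\}.$$ Then $\chi([Z,R_k>0,\ k=1,\dots,r])$ is equal to $$\sum_{i=0}^r\frac{1}{2^{r+i}}\sum_{I\subset\{1,\dots,r\},\ \sharp I=i}\ \sum_{\varepsilon\in\{\pm1\}^i}\Big(\prod_{j\in I}\varepsilon_j\Big)[Z,R_{I,\varepsilon}].$$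
   Context: **The ring $K_0(\mathrm{Var}_{\mathbb R})$.** A Zariski-constructible real algebraic variety is given (as a reduced variety over $\mathbb R$) by finitely many real polynomial equations $P_i=0$ and inequations $Q_j\neq 0$ in some affine space. $K_0(\mathrm{Var}_{\mathbb R})$ is the abelian group generated by isomorphism classes $[X]$ of Zariski-constructible real algebraic varieties, subject to $[X]=[Y]+[X\setminus Y]$ for $Y\subset X$ a closed subvariety, with ring structure induced by the product of constructible sets. "Constructible set in $\mathbb R^n$" means Zariski-constructible in this sense. **Formulas.** A basic semialgebraic formula $A$ in $n$ variables is a finite system of conditions $\{P_i=0,\ Q_j\neq 0,\ R_k>0\}$ (finitely many of each) with $P_i,Q_j,R_k\in\mathbb R[X_1,\dots,X_n]$; the conditions $R_k>0$ are called inequalities. $\{A,B\}$ denotes the conjunction of $A$ and $B$, so $[Z,R_{I,\varepsilon}]$ is the class of the constructible set in the variables $X_1,\dots,X_n$ and $Y_j$ ($j\in I$) defined by the conditions of $Z$ and of $R_{I,\varepsilon}$. **The map $\chi$** (with values in $K_0(\mathrm{Var}_{\mathbb R})\otimes\mathbb Z[\frac12]$). If $A$ has no inequality, $\chi([A])=[A]\in K_0(\mathrm{Var}_{\mathbb R})$ as a constructible set. By induction on the number of inequalities, for $A$ a formula in $n$ variables and $R\in\mathbb R[X_1,\dots,X_n]$, $$\chi([A,R>0]):=\tfrac14\big(\chi([A,Y^2=R])-\chi([A,Y^2=-R])\big)+\tfrac12\chi([A,R\neq0]),$$ where $Y$ is a new variable, so that $\{A,Y^2=\pm R\}$ is a formula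 in $n+1$ variables. *)

theory Defs
  imports Complex_Main "HOL-Library.FuncSet" "HOL-Library.Poly_Mapping"
begin

section \<open>Real polynomials and their complex points\<close>

text \<open>Polynomials with real coefficients in the variables \<open>x\<^sub>0, x\<^sub>1, \<dots>\<close>: a monomial is its
  finitely supported exponent function. So the variables \<open>X\<^sub>1, \<dots>, X\<^sub>n\<close> are \<open>x\<^sub>0, \<dots>, x\<^sub>n\<^sub>-\<^sub>1\<close>.\<close>

type_synonym rpoly = "(nat \<Rightarrow>\<^sub>0 nat) \<Rightarrow>\<^sub>0 real"

definition Var :: "nat \<Rightarrow> rpoly" where
  "Var i = Poly_Mapping.single (Poly_Mapping.single i 1) 1"

definition polys :: "nat \<Rightarrow> rpoly set" where
  "polys n = {p. \<forall>m\<in>Poly_Mapping.keys p. Poly_Mapping.keys m \<subseteq> {..<n}}"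

definition peval :: "rpoly \<Rightarrow> (nat \<Rightarrow> complex) \<Rightarrow> complex" where
  "peval p x = (\<Sum>m\<in>Poly_Mapping.keys p. of_real (Poly_Mapping.lookup p m) *
                  (\<Prod>i\<in>Poly_Mapping.keys m. x i ^ Poly_Mapping.lookup m i))"

definition affine_points :: "nat \<Rightarrow> (nat \<Rightarrow> complex) set" where
  "affine_points n = {..<n} \<rightarrow>\<^sub>E UNIV"

definition zero_locus :: "nat \<Rightarrow> rpoly set \<Rightarrow> (nat \<Rightarrow> complex) set" where
  "zero_locus n S = {x \<in> affine_points n. \<forall>p\<in>S. peval p x = 0}"

lemma peval_superset:
  assumes "finite A" "Poly_Mapping.keys p \<subseteq> A"
  shows "peval p x = (\<Sum>m\<in>A. of_real (Poly_Mapping.lookup p m) *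
                  (\<Prod>i\<in>Poly_Mapping.keys m. x i ^ Poly_Mapping.lookup m i))"
  unfolding peval_def using assms
  by (intro sum.mono_neutral_left) (auto simp: in_keys_iff)

lemma peval_add: "peval (p + q) x = peval p x + peval q x"
proof -
  let ?A = "Poly_Mapping.keys p \<union> Poly_Mapping.keys q"
  have "Poly_Mapping.keys (p + q) \<subseteq> ?A" by (rule keys_add)
  then show ?thesis
    by (simp add: peval_superset[of ?A] lookup_add sum.distrib ring_distribs)
qed

lemma peval_0 [simp]: "peval 0 x = 0"
  by (simp add: peval_def)

lemma peval_uminus: "peval (- p) x = - peval p x"
  using peval_add[of p "- p" x] by (simp add: minus_unique)

lemma peval_diff: "peval (p - q) x = peval p x - peval q x"
  using peval_add[of p "- q" x] by (simp add: peval_uminus)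

lemma peval_1 [simp]: "peval 1 x = 1"
  by (simp add: peval_def)

lemma peval_single:
  "peval (Poly_Mapping.single m a) x =
     of_real a * (\<Prod>i\<in>Poly_Mapping.keys m. x i ^ Poly_Mapping.lookup m i)"
  by (simp add: peval_def)

lemma peval_Var [simp]: "peval (Var i) x = x i"
  by (simp add: Var_def peval_single)

lemma rpoly_induct [case_names zero single add]:
  fixes p :: rpoly
  assumes "P 0" "\<And>m a. P (Poly_Mapping.single m a)" "\<And>p q. P p \<Longrightarrow> P q \<Longrightarrow> P (p + q)"
  shows "P p"
proof (induction p rule: update_induct)
  case const
  then show ?case by (rule assms(1))
next
  case (update f a b)
  then have "Poly_Mapping.update a b f = f + Poly_Mapping.single a b"
    by (intro poly_mapping_eqI)
      (auto simp: lookup_update lookup_add lookup_single in_keys_iff when_def)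
  with update assms show ?case by simp
qed

lemma monomial_value_add:
  fixes m k :: "nat \<Rightarrow>\<^sub>0 nat" and x :: "nat \<Rightarrow> complex"
  shows "(\<Prod>i\<in>Poly_Mapping.keys (m + k). x i ^ Poly_Mapping.lookup (m + k) i) =
    (\<Prod>i\<in>Poly_Mapping.keys m. x i ^ Poly_Mapping.lookup m i) *
    (\<Prod>i\<in>Poly_Mapping.keys k. x i ^ Poly_Mapping.lookup k i)"
proof -
  let ?A = "Poly_Mapping.keys m \<union> Poly_Mapping.keys k"
  have *: "(\<Prod>i\<in>Poly_Mapping.keys l. x i ^ Poly_Mapping.lookup l i) =
      (\<Prod>i\<in>?A. x i ^ Poly_Mapping.lookup l i)"
    if "Poly_Mapping.keys l \<subseteq> ?A" for l :: "nat \<Rightarrow>\<^sub>0 nat"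
    using that by (intro prod.mono_neutral_left) (auto simp: in_keys_iff)
  have "Poly_Mapping.keys m \<subseteq> ?A" "Poly_Mapping.keys k \<subseteq> ?A" by auto
  from this[THEN *] show ?thesis
    by (subst *[OF keys_add]) (simp only: lookup_add power_add prod.distrib)
qed

lemma peval_mult: "peval (p * q) x = peval p x * peval q x"
proof (induction p rule: rpoly_induct)
  case (single m a)
  show ?case
    by (induction q rule: rpoly_induct)
      (simp_all add: mult_single peval_single monomial_value_add peval_add ring_distribs)
qed (simp_all add: peval_add ring_distribs)

lemma peval_prod_list: "peval (prod_list ps) x = (\<Prod>p\<leftarrow>ps. peval p x)"
  by (induction ps) (simp_all add: peval_mult)

lemma one_in_polys [simp]: "1 \<in> polys n"
  by (simp add: polys_def)

lemma polys_mult: "p \<in> polys n \<Longrightarrow> q \<in> polys n \<Longrightarrow> p * q \<in> polys n"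
  unfolding polys_def using keys_mult[of p q] keys_add[where ?'b = nat and ?'a = nat] by blast

lemma prod_list_in_polys: "set ps \<subseteq> polys n \<Longrightarrow> prod_list ps \<in> polys n"
  by (induction ps) (simp_all add: polys_mult)


section \<open>Real algebraic varieties\<close>

text \<open>A reduced variety over \<open>\<real>\<close> embedded in affine \<open>n\<close>-space is determined by its set of
  complex points, cut out by real polynomials. The sets considered are the closed ones minus
  closed ones. They include every solution set of a finite system \<open>P\<^sub>i = 0\<close>, \<open>Q\<^sub>j \<noteq> 0\<close>
  (take \<open>\<Prod>\<^sub>j Q\<^sub>j\<close> for the removed part), and, unlike the latter, are stable under
  removing a closed subvariety, as needed for the defining relations of the Grothendieck group.\<close>

definition is_variety :: "nat \<Rightarrow> (nat \<Rightarrow> complex) set \<Rightarrow> bool" where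
  "is_variety n X \<longleftrightarrow> (\<exists>S T. finite S \<and> finite T \<and> S \<subseteq> polys n \<and> T \<subseteq> polys n \<and>
      X = zero_locus n S - zero_locus n T)"

typedef variety = "{(n, X). is_variety n X}"
  by (rule exI[of _ "(0, {})"]) (auto simp: is_variety_def intro!: exI[of _ "{}"])

definition adim :: "variety \<Rightarrow> nat" where
  "adim V = fst (Rep_variety V)"

definition points :: "variety \<Rightarrow> (nat \<Rightarrow> complex) set" where
  "points V = snd (Rep_variety V)"

lemma adim_points_Abs [simp]:
  assumes "is_variety n X"
  shows "adim (Abs_variety (n, X)) = n" "points (Abs_variety (n, X)) = X"
  using assms by (simp_all add: adim_def points_def Abs_variety_inverse)

text \<open>Regular functions are defined over \<open>\<real>\<close>: the local quotients have real coefficients.\<close>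

definition regular_function :: "variety \<Rightarrow> ((nat \<Rightarrow> complex) \<Rightarrow> complex) \<Rightarrow> bool" where
  "regular_function V f \<longleftrightarrow>
     (\<forall>x\<in>points V. \<exists>p\<in>polys (adim V). \<exists>q\<in>polys (adim V). peval q x \<noteq> 0 \<and>
        (\<forall>y\<in>points V. peval q y \<noteq> 0 \<longrightarrow> f y = peval p y / peval q y))"

definition regular_map :: "variety \<Rightarrow> variety \<Rightarrow> ((nat \<Rightarrow> complex) \<Rightarrow> (nat \<Rightarrow> complex)) \<Rightarrow> bool" where
  "regular_map V W f \<longleftrightarrow>
     f \<in> points V \<rightarrow> points W \<and> (\<forall>i<adim W. regular_function V (\<lambda>x. f x i))"

definition isomorphic :: "variety \<Rightarrow> variety \<Rightarrow> bool" where
  "isomorphic V W \<longleftrightarrow> (\<exists>f g. regular_map V W f \<and> regular_map W V g \<and>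
     (\<forall>x\<in>points V. g (f x) = x) \<and> (\<forall>y\<in>points W. f (g y) = y))"

definition closed_subvariety :: "variety \<Rightarrow> variety \<Rightarrow> bool" where
  "closed_subvariety Y X \<longleftrightarrow> adim Y = adim X \<and>
     (\<exists>S. finite S \<and> S \<subseteq> polys (adim X) \<and> points Y = points X \<inter> zero_locus (adim X) S)"


section \<open>Quotients of abelian groups by relations\<close>

inductive_set generated_subgroup :: "'a::ab_group_add set \<Rightarrow> 'a set" for S where
  zero: "0 \<in> generated_subgroup S"
| base: "x \<in> S \<Longrightarrow> x \<in> generated_subgroup S"
| diff: "x \<in> generated_subgroup S \<Longrightarrow> y \<in> generated_subgroup S \<Longrightarrow> x - y \<in> generated_subgroup S"

lemma generated_subgroup_uminus:
  "x \<in> generated_subgroup S \<Longrightarrow> - x \<in> generated_subgroup S"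
  using generated_subgroup.diff[OF generated_subgroup.zero] by force

lemma generated_subgroup_add:
  "x \<in> generated_subgroup S \<Longrightarrow> y \<in> generated_subgroup S \<Longrightarrow> x + y \<in> generated_subgroup S"
  using generated_subgroup.diff[of x S "- y"] by (simp add: generated_subgroup_uminus)

lemma equivp_generated_subgroup: "equivp (\<lambda>x y. x - y \<in> generated_subgroup S)"
proof (rule equivpI)
  show "reflp (\<lambda>x y. x - y \<in> generated_subgroup S)"
    by (simp add: reflp_def generated_subgroup.zero)
  show "symp (\<lambda>x y. x - y \<in> generated_subgroup S)"
    by (metis (no_types, lifting) generated_subgroup_uminus minus_diff_eq sympI)
  show "transp (\<lambda>x y. x - y \<in> generated_subgroup S)"
    by (metis (no_types, lifting) generated_subgroup_add diff_add_cancel add_diff_eq transpI)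
qed

lemma generated_subgroup_respects:
  fixes a b c d :: "'a::ab_group_add"
  assumes "a - b \<in> generated_subgroup S" "c - d \<in> generated_subgroup S"
  shows "(a + c) - (b + d) \<in> generated_subgroup S"
    and "(a - c) - (b - d) \<in> generated_subgroup S"
    and "(- a) - (- b) \<in> generated_subgroup S"
  using generated_subgroup_add[OF assms] generated_subgroup.diff[OF assms]
    generated_subgroup_uminus[OF assms(1)]
  by (simp_all add: algebra_simps)


section \<open>The Grothendieck group of real algebraic varieties\<close>

text \<open>The underlying abelian group of \<open>K\<^sub>0(Var\<^sub>\<real>)\<close>, as a quotient of the free abelian group on
  varieties. The relations \<open>[V] = [W]\<close> for \<open>V \<cong> W\<close> are listed explicitly instead of starting from
  isomorphism classes. Products of varieties play no role below, so the multiplication is not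
  introduced.\<close>

definition K0_relations :: "(variety \<Rightarrow>\<^sub>0 int) set" where
  "K0_relations =
     {frag_of V - frag_of W | V W. isomorphic V W} \<union>
     {frag_of X - (frag_of Y + frag_of U) | X Y U. closed_subvariety Y X \<and>
        adim U = adim X \<and> points U = points X - points Y}"

quotient_type K0 = "variety \<Rightarrow>\<^sub>0 int" /
  "\<lambda>x y. x - y \<in> generated_subgroup K0_relations"
  by (rule equivp_generated_subgroup)

instantiation K0 :: ab_group_add
begin

lift_definition zero_K0 :: K0 is 0 .
lift_definition plus_K0 :: "K0 \<Rightarrow> K0 \<Rightarrow> K0" is "(+)"
  by (rule generated_subgroup_respects)
lift_definition minus_K0 :: "K0 \<Rightarrow> K0 \<Rightarrow> K0" is "(-)"
  by (rule generated_subgroup_respects)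
lift_definition uminus_K0 :: "K0 \<Rightarrow> K0" is uminus
  by (rule generated_subgroup_respects)

instance
  by standard (transfer, simp add: algebra_simps generated_subgroup.zero)+

end

lift_definition K0_class :: "variety \<Rightarrow> K0" is frag_of .


section \<open>Tensor products of abelian groups\<close>

definition tensor_relations :: "('a::ab_group_add \<times> 'b::ab_group_add \<Rightarrow>\<^sub>0 int) set" where
  "tensor_relations =
     {frag_of (a + a', b) - (frag_of (a, b) + frag_of (a', b)) | a a' b. True} \<union>
     {frag_of (a, b + b') - (frag_of (a, b) + frag_of (a, b')) | a b b'. True}"

quotient_type (overloaded) ('a, 'b) tensor =
  "('a::ab_group_add \<times> 'b::ab_group_add) \<Rightarrow>\<^sub>0 int" /
  "\<lambda>x y. x - y \<in> generated_subgroup tensor_relations"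
  by (rule equivp_generated_subgroup)

instantiation tensor :: (ab_group_add, ab_group_add) ab_group_add
begin

lift_definition zero_tensor :: "('a, 'b) tensor" is 0 .
lift_definition plus_tensor :: "('a, 'b) tensor \<Rightarrow> ('a, 'b) tensor \<Rightarrow> ('a, 'b) tensor" is "(+)"
  by (rule generated_subgroup_respects)
lift_definition minus_tensor :: "('a, 'b) tensor \<Rightarrow> ('a, 'b) tensor \<Rightarrow> ('a, 'b) tensor" is "(-)"
  by (rule generated_subgroup_respects)
lift_definition uminus_tensor :: "('a, 'b) tensor \<Rightarrow> ('a, 'b) tensor" is uminus
  by (rule generated_subgroup_respects)

instance
  by standard (transfer, simp add: algebra_simps generated_subgroup.zero)+

end

lift_definition tensor_of :: "'a::ab_group_add \<Rightarrow> 'b::ab_group_add \<Rightarrow> ('a, 'b) tensor"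
    (infix \<open>\<otimes>\<^sub>\<int>\<close> 75)
  is "\<lambda>a b. frag_of (a, b)" .

text \<open>If \<open>'b\<close> is a ring, the tensor product is a \<open>'b\<close>-module via \<open>c (a \<otimes> b) = a \<otimes> c b\<close>.\<close>

lemma tensor_scale_respects:
  fixes c :: "'b::comm_ring_1" and x y :: "'a::ab_group_add \<times> 'b \<Rightarrow>\<^sub>0 int"
  assumes "x - y \<in> generated_subgroup tensor_relations"
  shows "frag_extend (\<lambda>(a, b). frag_of (a, c * b)) x - frag_extend (\<lambda>(a, b). frag_of (a, c * b)) y
         \<in> generated_subgroup tensor_relations"
proof -
  let ?h = "frag_extend (\<lambda>(a, b). frag_of (a, c * b)) :: ('a \<times> 'b \<Rightarrow>\<^sub>0 int) \<Rightarrow> _"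
  have "?h z \<in> generated_subgroup tensor_relations"
    if "z \<in> generated_subgroup tensor_relations" for z
    using that
  proof induction
    case (base z)
    then consider
        (left) a a' b where "z = frag_of (a + a', b) - (frag_of (a, b) + frag_of (a', b))"
      | (right) a b b' where "z = frag_of (a, b + b') - (frag_of (a, b) + frag_of (a, b'))"
      unfolding tensor_relations_def by blast
    then have "?h z \<in> tensor_relations"
    proof cases
      case left
      then show ?thesis
        unfolding tensor_relations_def by (simp add: frag_extend_diff frag_extend_add) blast
    next
      case right
      then show ?thesis
        unfolding tensor_relations_def
        by (simp add: frag_extend_diff frag_extend_add distrib_left) blast
    qed
    then show ?case by (rule generated_subgroup.base)
  qed (auto simp: frag_extend_diff intro: generated_subgroup.intros)
  from this[OF assms] show ?thesis by (simp add: frag_extend_diff)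
qed

lift_definition tensor_scale ::
    "'b::comm_ring_1 \<Rightarrow> ('a::ab_group_add, 'b) tensor \<Rightarrow> ('a, 'b) tensor" (infixr \<open>\<cdot>\<^sub>\<otimes>\<close> 75)
  is "\<lambda>c. frag_extend (\<lambda>(a, b). frag_of (a, c * b))"
  by (rule tensor_scale_respects)

lemma tensor_of_add_left: "(a + a') \<otimes>\<^sub>\<int> b = a \<otimes>\<^sub>\<int> b + a' \<otimes>\<^sub>\<int> b"
  by transfer (rule generated_subgroup.base, unfold tensor_relations_def, blast)

lemma tensor_of_add_right: "a \<otimes>\<^sub>\<int> (b + b') = a \<otimes>\<^sub>\<int> b + a \<otimes>\<^sub>\<int> b'"
  by transfer (rule generated_subgroup.base, unfold tensor_relations_def, blast)

lemma tensor_scale_of: "c \<cdot>\<^sub>\<otimes> (a \<otimes>\<^sub>\<int> b) = a \<otimes>\<^sub>\<int> (c * b)"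
  by transfer (simp add: generated_subgroup.zero)

lemma tensor_scale_add_right: "c \<cdot>\<^sub>\<otimes> (x + y) = c \<cdot>\<^sub>\<otimes> x + c \<cdot>\<^sub>\<otimes> y"
  by transfer (simp add: frag_extend_add generated_subgroup.zero)

lemma tensor_scale_diff_right: "c \<cdot>\<^sub>\<otimes> (x - y) = c \<cdot>\<^sub>\<otimes> x - c \<cdot>\<^sub>\<otimes> y"
  by transfer (simp add: frag_extend_diff generated_subgroup.zero)

lemma tensor_scale_zero_right: "c \<cdot>\<^sub>\<otimes> 0 = 0"
  by transfer (simp add: generated_subgroup.zero)

lemma tensor_induct [case_names zero of diff]:
  assumes "P 0" "\<And>a b. P (a \<otimes>\<^sub>\<int> b)" "\<And>x y. P x \<Longrightarrow> P y \<Longrightarrow> P (x - y)"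
  shows "P x"
proof -
  have "P (abs_tensor c)" for c
  proof (induction c rule: frag_induction[OF subset_UNIV])
    case 1
    then show ?case using assms(1) by (simp add: zero_tensor_def)
  next
    case (2 z)
    then show ?case using assms(2)[of "fst z" "snd z"] by (simp add: tensor_of.abs_eq)
  next
    case (3 a b)
    then show ?case using assms(3)[OF 3] by (simp add: minus_tensor.abs_eq)
  qed
  then show ?thesis by (rule tensor.abs_induct)
qed

lemma module_tensor_scale: "module (\<cdot>\<^sub>\<otimes>)"
proof
  fix c d :: 'a and x y :: "('b, 'a) tensor"
  show "c \<cdot>\<^sub>\<otimes> (x + y) = c \<cdot>\<^sub>\<otimes> x + c \<cdot>\<^sub>\<otimes> y" by (rule tensor_scale_add_right)
  show "(c + d) \<cdot>\<^sub>\<otimes> x = c \<cdot>\<^sub>\<otimes> x + d \<cdot>\<^sub>\<otimes> x"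
    by (induction x rule: tensor_induct)
      (simp_all add: tensor_scale_zero_right tensor_scale_of tensor_scale_diff_right
        distrib_right tensor_of_add_right)
  show "c \<cdot>\<^sub>\<otimes> (d \<cdot>\<^sub>\<otimes> x) = (c * d) \<cdot>\<^sub>\<otimes> x"
    by (induction x rule: tensor_induct)
      (simp_all add: tensor_scale_zero_right tensor_scale_of tensor_scale_diff_right mult.assoc)
  show "1 \<cdot>\<^sub>\<otimes> x = x"
    by (induction x rule: tensor_induct)
      (simp_all add: tensor_scale_zero_right tensor_scale_of tensor_scale_diff_right)
qed


section \<open>The ring of dyadic rationals\<close>

typedef dyadic = "{q::rat. \<exists>a k. q = of_int a / 2 ^ k}"
  by (rule exI[of _ 0]) (auto intro!: exI[of _ 0])

setup_lifting type_definition_dyadic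

instantiation dyadic :: comm_ring_1
begin

lift_definition zero_dyadic :: dyadic is 0 by (auto intro!: exI[of _ 0])
lift_definition one_dyadic :: dyadic is 1 by (rule exI[of _ 1]) (auto intro!: exI[of _ 0])
lift_definition plus_dyadic :: "dyadic \<Rightarrow> dyadic \<Rightarrow> dyadic" is "(+)"
proof -
  fix p q :: rat
  assume "\<exists>a k. p = of_int a / 2 ^ k" "\<exists>a k. q = of_int a / 2 ^ k"
  then obtain a k b l where "p = of_int a / 2 ^ k" "q = of_int b / 2 ^ l" by blast
  then have "p + q = of_int (a * 2 ^ l + b * 2 ^ k) / 2 ^ (k + l)"
    by (simp add: \<open>p = _\<close> \<open>q = _\<close> add_divide_distrib power_add)
  then show "\<exists>a k. p + q = of_int a / 2 ^ k" by blast
qed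
lift_definition uminus_dyadic :: "dyadic \<Rightarrow> dyadic" is uminus
  by (metis minus_divide_left of_int_minus)
lift_definition minus_dyadic :: "dyadic \<Rightarrow> dyadic \<Rightarrow> dyadic" is "(-)"
proof -
  fix p q :: rat
  assume "\<exists>a k. p = of_int a / 2 ^ k" "\<exists>a k. q = of_int a / 2 ^ k"
  then obtain a k b l where "p = of_int a / 2 ^ k" "q = of_int b / 2 ^ l" by blast
  then have "p - q = of_int (a * 2 ^ l - b * 2 ^ k) / 2 ^ (k + l)"
    by (simp add: \<open>p = _\<close> \<open>q = _\<close> diff_divide_distrib power_add)
  then show "\<exists>a k. p - q = of_int a / 2 ^ k" by blast
qed
lift_definition times_dyadic :: "dyadic \<Rightarrow> dyadic \<Rightarrow> dyadic" is "(*)"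
proof -
  fix p q :: rat
  assume "\<exists>a k. p = of_int a / 2 ^ k" "\<exists>a k. q = of_int a / 2 ^ k"
  then obtain a k b l where "p = of_int a / 2 ^ k" "q = of_int b / 2 ^ l" by blast
  then have "p * q = of_int (a * b) / 2 ^ (k + l)"
    by (simp add: power_add)
  then show "\<exists>a k. p * q = of_int a / 2 ^ k" by blast
qed

instance
  by standard (transfer, simp add: algebra_simps)+

end

lift_definition half :: dyadic is "1 / 2"
  by (rule exI[of _ 1], rule exI[of _ 1]) simp

lemma half_plus_half: "half + half = 1"
  by transfer simp

type_synonym K0_half = "(K0, dyadic) tensor"


section \<open>Basic semialgebraic formulas\<close>

text \<open>\<open>Formula n Ps Qs Rs\<close> is the system \<open>P = 0\<close>, \<open>Q \<noteq> 0\<close>, \<open>R > 0\<close> (for \<open>P\<close> in \<open>Ps\<close>, \<open>Q\<close> in \<open>Qs\<close>,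
  \<open>R\<close> in \<open>Rs\<close>) in the \<open>n\<close> variables \<open>x\<^sub>0, \<dots>, x\<^sub>n\<^sub>-\<^sub>1\<close>.\<close>

datatype basic_formula =
  Formula (nvars: nat) (equations: "rpoly list") (inequations: "rpoly list")
    (inequalities: "rpoly list")

definition wf_formula :: "basic_formula \<Rightarrow> bool" where
  "wf_formula A \<longleftrightarrow>
     set (equations A) \<union> set (inequations A) \<union> set (inequalities A) \<subseteq> polys (nvars A)"

definition formula_conj :: "basic_formula \<Rightarrow> basic_formula \<Rightarrow> basic_formula" where
  "formula_conj A B = Formula (max (nvars A) (nvars B)) (equations A @ equations B)
     (inequations A @ inequations B) (inequalities A @ inequalities B)"

definition constructible_set :: "basic_formula \<Rightarrow> (nat \<Rightarrow> complex) set" where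
  "constructible_set A = {x \<in> affine_points (nvars A).
     (\<forall>p\<in>set (equations A). peval p x = 0) \<and> (\<forall>q\<in>set (inequations A). peval q x \<noteq> 0)}"

lemma is_variety_constructible_set:
  assumes "wf_formula A"
  shows "is_variety (nvars A) (constructible_set A)"
  unfolding is_variety_def
proof (intro exI conjI)
  show "set (equations A) \<subseteq> polys (nvars A)" "{prod_list (inequations A)} \<subseteq> polys (nvars A)"
    using assms by (auto simp: wf_formula_def intro!: prod_list_in_polys)
  show "constructible_set A =
      zero_locus (nvars A) (set (equations A)) - zero_locus (nvars A) {prod_list (inequations A)}"
    by (auto simp: constructible_set_def zero_locus_def peval_prod_list prod_list_zero_iff)
qed simp_all

text \<open>The class \<open>[A] \<otimes> 1\<close> of a formula without inequalities; meant for well-formed \<open>A\<close>, where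
  \<open>Abs_variety\<close> is applied to a variety by the previous lemma.\<close>

definition algebraic_class :: "basic_formula \<Rightarrow> K0_half" where
  "algebraic_class A = K0_class (Abs_variety (nvars A, constructible_set A)) \<otimes>\<^sub>\<int> 1"

text \<open>In the recursion for \<open>\<chi>\<close>, the new variable \<open>Y\<close> is \<open>x\<^sub>n\<close>, and the inequalities are eliminated
  in the order in which they are listed.\<close>

function chi :: "basic_formula \<Rightarrow> K0_half" where
  "chi (Formula n Ps Qs []) = algebraic_class (Formula n Ps Qs [])"
| "chi (Formula n Ps Qs (R # Rs)) =
     (half ^ 2) \<cdot>\<^sub>\<otimes> (chi (Formula (n + 1) (Ps @ [Var n ^ 2 - R]) Qs Rs)
                  - chi (Formula (n + 1) (Ps @ [Var n ^ 2 - (- R)]) Qs Rs))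
     + half \<cdot>\<^sub>\<otimes> chi (Formula n Ps (Qs @ [R]) Rs)"
  by pat_completeness auto
termination
  by (relation "measure (\<lambda>A. length (inequalities A))") simp_all


section \<open>The constructible sets attached to a choice of signs\<close>

text \<open>The formula \<open>Y\<^sub>j\<^sup>2 = \<epsilon>\<^sub>j R\<^sub>j\<close> (\<open>j \<in> I\<close>), \<open>R\<^sub>k \<noteq> 0\<close> (\<open>k \<in> {1..r} - I\<close>) for \<open>I \<subseteq> {1..r}\<close>. The
  variables \<open>Y\<^sub>j\<close>, \<open>j \<in> I\<close>, in increasing order of \<open>j\<close>, follow the \<open>n\<close> variables of the \<open>R\<^sub>k\<close>.\<close>

definition Y_var :: "nat \<Rightarrow> nat set \<Rightarrow> nat \<Rightarrow> rpoly" where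
  "Y_var n I j = Var (n + card {k \<in> I. k < j})"

definition R_formula ::
    "nat \<Rightarrow> nat \<Rightarrow> (nat \<Rightarrow> rpoly) \<Rightarrow> nat set \<Rightarrow> (nat \<Rightarrow> int) \<Rightarrow> basic_formula" where
  "R_formula n r R I \<epsilon> = Formula (n + card I)
     (map (\<lambda>j. Y_var n I j ^ 2 - of_int (\<epsilon> j) * R j) (sorted_list_of_set I))
     (map R (sorted_list_of_set ({1..r} - I))) []"

definition positivity_formula :: "nat \<Rightarrow> nat \<Rightarrow> (nat \<Rightarrow> rpoly) \<Rightarrow> basic_formula" where
  "positivity_formula n r R = Formula n [] [] (map R [1..<r + 1])"

end

theory Submission
  imports Defs
begin

text \<open>
  Unfolding the recursion for \<open>\<chi>\<close> eliminates the inequalities one after the other, and each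
  elimination of \<open>R\<^sub>k > 0\<close> offers three choices: a new variable with \<open>Y\<^sup>2 = R\<^sub>k\<close> (weight \<open>1/4\<close>), a
  new variable with \<open>Y\<^sup>2 = - R\<^sub>k\<close> (weight \<open>- 1/4\<close>), or no new variable and \<open>R\<^sub>k \<noteq> 0\<close> (weight
  \<open>1/2\<close>). A sequence of \<open>r\<close> choices is a pair \<open>(I, \<epsilon>)\<close>, with \<open>I\<close> the set of indices at which a
  variable was introduced and \<open>\<epsilon>\<close> the signs there. Its total weight is
  \<open>(1/4)\<^sup>i (1/2)\<^sup>r\<^sup>-\<^sup>i \<Prod>\<epsilon>\<^sub>j = (1/2)\<^sup>r\<^sup>+\<^sup>i \<Prod>\<epsilon>\<^sub>j\<close> with \<open>i = \<sharp>I\<close>, and the system left at the end is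
  \<open>{Z, R\<^sub>I\<^sub>,\<^sub>\<epsilon>}\<close>.

  The indices are eliminated in increasing order and the \<open>Y\<^sub>j\<close> are numbered by increasing \<open>j\<close>, so
  the recursion produces literally the formulas on the right-hand side, and what remains is
  bookkeeping of weights. The expansion \<open>chi_expansion\<close> is therefore an induction on the finite index
  set that removes its least element; the number of variables and the conditions already imposed
  have to vary in it, because each elimination changes them.
\<close>

text \<open>The system that remains of \<open>P = 0, Q \<noteq> 0, R\<^sub>k > 0\<close> (\<open>k \<in> K\<close>) once the inequalities have been
  eliminated according to \<open>(I, \<epsilon>)\<close>. Removing the least index from \<open>K\<close> and adding
  a condition to \<open>Ps\<close> or \<open>Qs\<close> gives a system of the same kind, which is what the induction on \<open>K\<close>
  uses.\<close>

definition eliminated_formula ::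
    "nat \<Rightarrow> rpoly list \<Rightarrow> rpoly list \<Rightarrow> (nat \<Rightarrow> rpoly) \<Rightarrow> nat set \<Rightarrow> nat set \<Rightarrow> (nat \<Rightarrow> int)
      \<Rightarrow> basic_formula" where
  "eliminated_formula n Ps Qs R K I \<epsilon> = Formula (n + card I)
     (Ps @ map (\<lambda>j. Y_var n I j ^ 2 - of_int (\<epsilon> j) * R j) (sorted_list_of_set I))
     (Qs @ map R (sorted_list_of_set (K - I))) []"

lemma sorted_list_of_set_insert_least:
  assumes "finite A" "\<forall>x\<in>A. a < x"
  shows "sorted_list_of_set (insert a A) = a # sorted_list_of_set A"
proof -
  have "a \<notin> A" using assms(2) by blast
  moreover have "insort a (sorted_list_of_set A) = a # sorted_list_of_set A"
    using assms by (intro insort_is_Cons) auto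
  ultimately show ?thesis
    using assms(1) by simp
qed

lemma Y_var_insert_least:
  assumes "finite I" "\<forall>x\<in>I. a < x"
  shows "Y_var n (insert a I) a = Var n"
    and "j \<in> I \<Longrightarrow> Y_var n (insert a I) j = Y_var (n + 1) I j"
proof -
  have "{k \<in> insert a I. k < a} = {}" using assms(2) by auto
  then show "Y_var n (insert a I) a = Var n" by (simp only: Y_var_def card.empty add_0_right)
next
  assume "j \<in> I"
  with assms(2) have "{k \<in> insert a I. k < j} = insert a {k \<in> I. k < j}" by auto
  moreover have "a \<notin> {k \<in> I. k < j}" using assms(2) by auto
  ultimately show "Y_var n (insert a I) j = Y_var (n + 1) I j"
    using assms(1) by (simp add: Y_var_def)
qed

lemma eliminated_formula_least_notin:
  assumes "finite A" "\<forall>x\<in>A. a < x" "I \<subseteq> A"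
  shows "eliminated_formula n Ps Qs R (insert a A) I \<epsilon> =
    eliminated_formula n Ps (Qs @ [R a]) R A I \<epsilon>"
proof -
  have "insert a A - I = insert a (A - I)" using assms(2,3) by blast
  moreover have "sorted_list_of_set (insert a (A - I)) = a # sorted_list_of_set (A - I)"
    using assms(1,2) by (intro sorted_list_of_set_insert_least) auto
  ultimately show ?thesis by (simp add: eliminated_formula_def)
qed

text \<open>Since \<open>a\<close> is the least index, its variable is the first new one, \<open>x\<^sub>n\<close>, which is the one that
  the recursion for \<open>\<chi>\<close> introduces; the numbering of the others then starts at \<open>n + 1\<close>.\<close>

lemma eliminated_formula_least_in:
  assumes "finite A" "\<forall>x\<in>A. a < x" "I \<subseteq> A"
  shows "eliminated_formula n Ps Qs R (insert a A) (insert a I) (\<epsilon>(a := s)) =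
    eliminated_formula (n + 1) (Ps @ [Var n ^ 2 - of_int s * R a]) Qs R A I \<epsilon>"
proof -
  have I: "finite I" "\<forall>x\<in>I. a < x" and "a \<notin> I" "a \<notin> A"
    using assms by (auto intro: finite_subset)
  have "map (\<lambda>j. Y_var n (insert a I) j ^ 2 - of_int ((\<epsilon>(a := s)) j) * R j)
          (sorted_list_of_set (insert a I)) =
        (Var n ^ 2 - of_int s * R a) #
          map (\<lambda>j. Y_var (n + 1) I j ^ 2 - of_int (\<epsilon> j) * R j) (sorted_list_of_set I)"
    unfolding sorted_list_of_set_insert_least[OF I]
    using I \<open>a \<notin> I\<close> by (auto simp: Y_var_insert_least)
  moreover have "insert a A - insert a I = A - I"
    using \<open>a \<notin> A\<close> by blast
  ultimately show ?thesis
    using I \<open>a \<notin> I\<close> by (simp add: eliminated_formula_def)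
qed

lemma sum_Pow_insert:
  assumes "finite A" "a \<notin> A"
  shows "(\<Sum>I\<in>Pow (insert a A). f I) = (\<Sum>I\<in>Pow A. f I) + (\<Sum>I\<in>Pow A. f (insert a I))"
proof -
  have "inj_on (insert a) (Pow A)"
    using assms(2) by (intro inj_onI) (metis Pow_iff insert_ident subsetD)
  moreover have "Pow A \<inter> insert a ` Pow A = {}"
    using assms(2) by blast
  ultimately show ?thesis
    using assms(1) by (simp add: Pow_insert sum.union_disjoint sum.reindex)
qed

lemma sum_PiE_insert:
  assumes "a \<notin> I"
  shows "(\<Sum>\<epsilon>\<in>insert a I \<rightarrow>\<^sub>E S. f \<epsilon>) = (\<Sum>s\<in>S. \<Sum>\<epsilon>\<in>I \<rightarrow>\<^sub>E S. f (\<epsilon>(a := s)))"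
proof -
  have "(\<Sum>\<epsilon>\<in>insert a I \<rightarrow>\<^sub>E S. f \<epsilon>) =
      (\<Sum>(s, \<epsilon>)\<in>S \<times> (I \<rightarrow>\<^sub>E S). f (\<epsilon>(a := s)))"
    unfolding PiE_insert_eq using inj_combinator[OF assms, of "\<lambda>_. S"]
    by (subst sum.reindex) (auto simp: case_prod_unfold)
  then show ?thesis by (simp add: sum.cartesian_product)
qed

text \<open>Subsets \<open>I\<close> of \<open>insert a A\<close> without \<open>a\<close> account for the term with \<open>R\<^sub>a \<noteq> 0\<close> of the recursion, and
  those with \<open>a\<close>, split by the sign \<open>\<epsilon>\<^sub>a\<close>, for the two terms with \<open>Y\<^sup>2 = \<plusminus>R\<^sub>a\<close>. Passing from
  \<open>A\<close> to \<open>insert a A\<close> raises \<open>card K + card I\<close> by one in the first case and by two in the second, as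
  it should with weights \<open>1/2\<close> and \<open>1/4\<close>.\<close>

theorem chi_expansion:
  assumes "finite K"
  shows "chi (Formula n Ps Qs (map R (sorted_list_of_set K))) =
    (\<Sum>I\<in>Pow K. half ^ (card K + card I) \<cdot>\<^sub>\<otimes>
      (\<Sum>\<epsilon>\<in>I \<rightarrow>\<^sub>E {-1, 1}.
        of_int (\<Prod>j\<in>I. \<epsilon> j) \<cdot>\<^sub>\<otimes> algebraic_class (eliminated_formula n Ps Qs R K I \<epsilon>)))"
  using assms
proof (induction K arbitrary: n Ps Qs rule: finite_linorder_min_induct)
  case empty
  interpret module "(\<cdot>\<^sub>\<otimes>) :: dyadic \<Rightarrow> K0_half \<Rightarrow> K0_half"
    by (rule module_tensor_scale)
  show ?case by (simp add: eliminated_formula_def)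
next
  case (insert a A)
  interpret module "(\<cdot>\<^sub>\<otimes>) :: dyadic \<Rightarrow> K0_half \<Rightarrow> K0_half"
    by (rule module_tensor_scale)
  have a: "a \<notin> A" using insert.hyps by blast
  let ?w = "\<lambda>I \<epsilon>. of_int (\<Prod>j\<in>I. \<epsilon> j) :: dyadic"
  let ?S = "\<lambda>n Ps Qs I. \<Sum>\<epsilon>\<in>I \<rightarrow>\<^sub>E {-1, 1}.
    ?w I \<epsilon> \<cdot>\<^sub>\<otimes> algebraic_class (eliminated_formula n Ps Qs R A I \<epsilon>)"
  let ?T = "\<lambda>I. \<Sum>\<epsilon>\<in>I \<rightarrow>\<^sub>E {-1, 1}.
    ?w I \<epsilon> \<cdot>\<^sub>\<otimes> algebraic_class (eliminated_formula n Ps Qs R (insert a A) I \<epsilon>)"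
  let ?P = "\<lambda>s. Ps @ [Var n ^ 2 - of_int s * R a]"
  have without_a: "half ^ (card (insert a A) + card I) \<cdot>\<^sub>\<otimes> ?T I =
      half \<cdot>\<^sub>\<otimes> half ^ (card A + card I) \<cdot>\<^sub>\<otimes> ?S n Ps (Qs @ [R a]) I" if "I \<in> Pow A" for I
    using that insert.hyps a by (simp add: eliminated_formula_least_notin)
  have with_a: "half ^ (card (insert a A) + card (insert a I)) \<cdot>\<^sub>\<otimes> ?T (insert a I) =
      half ^ 2 \<cdot>\<^sub>\<otimes> (half ^ (card A + card I) \<cdot>\<^sub>\<otimes> ?S (n + 1) (?P 1) Qs I -
                    half ^ (card A + card I) \<cdot>\<^sub>\<otimes> ?S (n + 1) (?P (-1)) Qs I)"
    if "I \<in> Pow A" for I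
  proof -
    have I: "I \<subseteq> A" "finite I" "a \<notin> I"
      using that insert.hyps(1) a by (auto intro: finite_subset)
    have w: "?w (insert a I) (\<epsilon>(a := s)) = of_int s * ?w I \<epsilon>" for s and \<epsilon> :: "nat \<Rightarrow> int"
    proof -
      have "(\<Prod>j\<in>I. (\<epsilon>(a := s)) j) = (\<Prod>j\<in>I. \<epsilon> j)"
        using I(3) by (intro prod.cong) auto
      with I show ?thesis by simp
    qed
    have "?T (insert a I) = (\<Sum>s\<in>{-1, 1}. of_int s \<cdot>\<^sub>\<otimes> ?S (n + 1) (?P s) Qs I)"
      unfolding sum_PiE_insert[OF I(3)] w eliminated_formula_least_in[OF insert.hyps(1,2) I(1)]
      by (simp only: scale_sum_right scale_scale)
    also have "\<dots> = ?S (n + 1) (?P 1) Qs I - ?S (n + 1) (?P (-1)) Qs I"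
      by simp
    finally have "?T (insert a I) = \<dots>" .
    moreover have "half ^ (card (insert a A) + card (insert a I)) =
        half ^ 2 * half ^ (card A + card I)"
      using I insert.hyps(1) a by (simp add: power_add power2_eq_square)
    ultimately show ?thesis
      by (simp only: scale_scale [symmetric] scale_right_diff_distrib)
  qed
  have "chi (Formula n Ps Qs (map R (sorted_list_of_set (insert a A)))) =
      half ^ 2 \<cdot>\<^sub>\<otimes> (chi (Formula (n + 1) (?P 1) Qs (map R (sorted_list_of_set A)))
                    - chi (Formula (n + 1) (?P (-1)) Qs (map R (sorted_list_of_set A))))
      + half \<cdot>\<^sub>\<otimes> chi (Formula n Ps (Qs @ [R a]) (map R (sorted_list_of_set A)))"
    unfolding sorted_list_of_set_insert_least[OF insert.hyps(1,2)] by simp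
  also have "\<dots> = (\<Sum>I\<in>Pow A. half ^ 2 \<cdot>\<^sub>\<otimes>
        (half ^ (card A + card I) \<cdot>\<^sub>\<otimes> ?S (n + 1) (?P 1) Qs I -
         half ^ (card A + card I) \<cdot>\<^sub>\<otimes> ?S (n + 1) (?P (-1)) Qs I))
      + (\<Sum>I\<in>Pow A. half \<cdot>\<^sub>\<otimes> half ^ (card A + card I) \<cdot>\<^sub>\<otimes> ?S n Ps (Qs @ [R a]) I)"
    unfolding insert.IH
    by (simp only: scale_sum_right[where A = "Pow A"] sum_subtractf[where A = "Pow A", symmetric])
  also have "\<dots> =
      (\<Sum>I\<in>Pow A. half ^ (card (insert a A) + card (insert a I)) \<cdot>\<^sub>\<otimes> ?T (insert a I))
      + (\<Sum>I\<in>Pow A. half ^ (card (insert a A) + card I) \<cdot>\<^sub>\<otimes> ?T I)"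
    by (simp only: with_a without_a cong: sum.cong)
  also have "\<dots> = (\<Sum>I\<in>Pow (insert a A). half ^ (card (insert a A) + card I) \<cdot>\<^sub>\<otimes> ?T I)"
    unfolding sum_Pow_insert[OF insert.hyps(1) a] by (rule add.commute)
  finally show ?case .
qed

lemma formula_conj_R_formula:
  assumes "inequalities Z = []"
  shows "formula_conj Z (R_formula (nvars Z) r R I \<epsilon>) =
    eliminated_formula (nvars Z) (equations Z) (inequations Z) R {1..r} I \<epsilon>"
  using assms by (simp add: formula_conj_def R_formula_def eliminated_formula_def)

lemma formula_conj_positivity_formula:
  assumes "inequalities Z = []"
  shows "formula_conj Z (positivity_formula (nvars Z) r R) =
    Formula (nvars Z) (equations Z) (inequations Z) (map R (sorted_list_of_set {1..r}))"
proof -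
  have "{1..r} = {1..<r + 1}" by auto
  with assms show ?thesis
    by (simp add: formula_conj_def positivity_formula_def del: upt_Suc)
qed

theorem proposition2p1p2:
  fixes n r :: nat and Z :: basic_formula and R :: "nat \<Rightarrow> rpoly"
  assumes "wf_formula Z" and "nvars Z = n" and "inequalities Z = []"
    and "\<And>k. k \<in> {1..r} \<Longrightarrow> R k \<in> polys n"
  shows "chi (formula_conj Z (positivity_formula n r R)) =
    (\<Sum>i = 0..r. (half ^ (r + i)) \<cdot>\<^sub>\<otimes>
      (\<Sum>I | I \<subseteq> {1..r} \<and> card I = i.
        \<Sum>\<epsilon> \<in> I \<rightarrow>\<^sub>E {-1, 1}.
          of_int (\<Prod>j\<in>I. \<epsilon> j) \<cdot>\<^sub>\<otimes> algebraic_class (formula_conj Z (R_formula n r R I \<epsilon>))))"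
proof -
  interpret module "(\<cdot>\<^sub>\<otimes>) :: dyadic \<Rightarrow> K0_half \<Rightarrow> K0_half"
    by (rule module_tensor_scale)
  let ?T = "\<lambda>I. \<Sum>\<epsilon> \<in> I \<rightarrow>\<^sub>E {-1, 1}.
    of_int (\<Prod>j\<in>I. \<epsilon> j) \<cdot>\<^sub>\<otimes> algebraic_class (formula_conj Z (R_formula n r R I \<epsilon>))"
  have card_le: "card ` Pow {1..r} \<subseteq> {0..r}"
    using card_mono[of "{1..r}"] by fastforce
  have "chi (formula_conj Z (positivity_formula n r R)) =
      (\<Sum>I\<in>Pow {1..r}. half ^ (r + card I) \<cdot>\<^sub>\<otimes> ?T I)"
    unfolding assms(2)[symmetric] formula_conj_R_formula[OF assms(3)]
      formula_conj_positivity_formula[OF assms(3)]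
    by (subst chi_expansion) simp_all
  also have "\<dots> = (\<Sum>i = 0..r. \<Sum>I | I \<in> Pow {1..r} \<and> card I = i. half ^ (r + card I) \<cdot>\<^sub>\<otimes> ?T I)"
    using card_le by (intro sum.group [symmetric]) auto
  also have "\<dots> = (\<Sum>i = 0..r. half ^ (r + i) \<cdot>\<^sub>\<otimes> (\<Sum>I | I \<subseteq> {1..r} \<and> card I = i. ?T I))"
    by (simp add: scale_sum_right)
  finally show ?thesis .
qed

end
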